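(* The four dimensional real Lie algebras $\mathfrak d_{4,\lambda}$ ($\lambda\ge\frac12$, $\lambda\neq\frac12,2$) and $\mathfrak h_4$ admit generalized complex structures of type $0$ and of type $2$, but not of type $1$.
   Context: The Lie algebras have basis $e_0,e_1,e_2,e_3$ and the following nonzero brackets (up to skew-symmetry): $\mathfrak d_{4,\lambda}$ (defined for real $\lambda\ge\frac12$): $[e_0,e_1]=\lambda e_1$, $[e_0,e_2]=(1-\lambda)e_2$, $[e_0,e_3]=e_3$, $[e_1,e_2]=e_3$. $\mathfrak h_4$: $[e_0,e_1]=e_1$, $[e_0,e_2]=e_1+e_2$, $[e_0,e_3]=2e_3$, $[e_1,e_2]=e_3$. A generalized complex structure on a real Lie algebra $\mathfrak g$ is an endomorphism $\mathcal J$ of $\mathfrak g\oplus\mathfrak g^*$ with $\mathcal J^2=-\mathrm{Id}$, orthogonal with respect to $\langle (x,\alpha),(y,\beta)\rangle=\frac12(\beta(x)+\alpha(y))$, and satisfying $[u,v]+\mathcal J[\mathcal Ju,v]+\mathcal J[u,\mathcal Jv]-[\mathcal Ju,\mathcal Jv]=0$ for all $u,v\in\mathfrak g\oplus\mathfrak g^*$, where $[(x,\alpha),(y,\beta)]=([x,y],-\beta\circ\mathrm{ad}(x)+\alpha\circ\mathrm{ad}(y))$. Write $\mathcal J=\begin{pmatrix}\mathcal J_1&\mathcal J_2\\ \mathcal J_3&\mathcal J_4\end{pmatrix}$ with respect to $\mathfrak g\oplus\mathfrak g^*$, so $\mathcal J_2:\mathfrak g^*\to\mathfrak g$. If $\dim\mathfrak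 g=2n$, $\mathcal J$ is of type $k$ when $\operatorname{rank}(\mathcal J_2)=2(n-k)$. *)

theory Defs
  imports "HOL-Analysis.Analysis"
begin

text \<open>
  A finite-dimensional real Lie algebra is a Euclidean space \<open>'a\<close> (only its vector space
  structure is used) with an explicit bracket; the dual space is \<open>'a \<Rightarrow>\<^sub>L real\<close>, which in
  finite dimension consists of all linear functionals.
\<close>

definition lie_bracket :: "('a::euclidean_space \<Rightarrow> 'a \<Rightarrow> 'a) \<Rightarrow> bool" where
  "lie_bracket br \<longleftrightarrow>
     bilinear br \<and>
     (\<forall>x. br x x = 0) \<and>
     (\<forall>x y z. br x (br y z) + br y (br z x) + br z (br x y) = 0)"

text \<open>\<open>Blinfun\<close> is meaningful here because a linear map on \<open>'a\<close> is bounded.\<close>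

definition ad :: "('a::euclidean_space \<Rightarrow> 'a \<Rightarrow> 'a) \<Rightarrow> 'a \<Rightarrow> 'a \<Rightarrow>\<^sub>L 'a" where
  "ad br x = Blinfun (br x)"

lemma ad_apply:
  assumes "lie_bracket br"
  shows "blinfun_apply (ad br x) y = br x y"
  using assms
  by (simp add: lie_bracket_def bilinear_def ad_def bounded_linear_Blinfun_apply linear_linear)

definition pairing ::
    "'a::euclidean_space \<times> ('a \<Rightarrow>\<^sub>L real) \<Rightarrow> 'a \<times> ('a \<Rightarrow>\<^sub>L real) \<Rightarrow> real" where
  "pairing u v = 1 / 2 * (blinfun_apply (snd v) (fst u) + blinfun_apply (snd u) (fst v))"

definition double_bracket ::
    "('a::euclidean_space \<Rightarrow> 'a \<Rightarrow> 'a) \<Rightarrow>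
     'a \<times> ('a \<Rightarrow>\<^sub>L real) \<Rightarrow> 'a \<times> ('a \<Rightarrow>\<^sub>L real) \<Rightarrow> 'a \<times> ('a \<Rightarrow>\<^sub>L real)" where
  "double_bracket br u v =
     (br (fst u) (fst v),
      - (snd v o\<^sub>L ad br (fst u)) + (snd u o\<^sub>L ad br (fst v)))"

definition generalized_complex_structure ::
    "('a::euclidean_space \<Rightarrow> 'a \<Rightarrow> 'a) \<Rightarrow>
     ('a \<times> ('a \<Rightarrow>\<^sub>L real) \<Rightarrow> 'a \<times> ('a \<Rightarrow>\<^sub>L real)) \<Rightarrow> bool" where
  "generalized_complex_structure br J \<longleftrightarrow>
     linear J \<and>
     (\<forall>u. J (J u) = - u) \<and>
     (\<forall>u v. pairing (J u) (J v) = pairing u v) \<and>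
     (\<forall>u v. double_bracket br u v + J (double_bracket br (J u) v)
            + J (double_bracket br u (J v)) - double_bracket br (J u) (J v) = 0)"

definition J2_block ::
    "('a::euclidean_space \<times> ('a \<Rightarrow>\<^sub>L real) \<Rightarrow> 'a \<times> ('a \<Rightarrow>\<^sub>L real)) \<Rightarrow>
     ('a \<Rightarrow>\<^sub>L real) \<Rightarrow> 'a" where
  "J2_block J \<alpha> = fst (J (0, \<alpha>))"

text \<open>The equation is stated over \<open>int\<close> to avoid truncated subtraction.\<close>

definition has_type ::
    "('a::euclidean_space \<times> ('a \<Rightarrow>\<^sub>L real) \<Rightarrow> 'a \<times> ('a \<Rightarrow>\<^sub>L real)) \<Rightarrow> nat \<Rightarrow> bool" where
  "has_type J k \<longleftrightarrow>
     (\<exists>n. DIM('a) = 2 * n \<and> int (dim (range (J2_block J))) = 2 * (int n - int k))"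

definition admits_gcs_of_type ::
    "('a::euclidean_space \<Rightarrow> 'a \<Rightarrow> 'a) \<Rightarrow> nat \<Rightarrow> bool" where
  "admits_gcs_of_type br k \<longleftrightarrow> (\<exists>J. generalized_complex_structure br J \<and> has_type J k)"

text \<open>
  The index type \<open>4\<close> consists of the residues \<open>0, 1, 2, 3\<close>, so \<open>basis4 0, \<dots>, basis4 3\<close> is the
  standard basis of \<open>real^4\<close>. The coefficient of \<open>[basis4 i, basis4 j]\<close> in the bilinear alternating
  extension of a bracket is the minor \<open>x\<^sub>i y\<^sub>j - x\<^sub>j y\<^sub>i\<close>.
\<close>

definition basis4 :: "4 \<Rightarrow> real^4" where
  "basis4 i = axis i 1"

definition minor :: "real^4 \<Rightarrow> real^4 \<Rightarrow> 4 \<Rightarrow> 4 \<Rightarrow> real" where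
  "minor x y i j = x $ i * y $ j - x $ j * y $ i"

definition d4_bracket :: "real \<Rightarrow> real^4 \<Rightarrow> real^4 \<Rightarrow> real^4" where
  "d4_bracket l x y =
     minor x y 0 1 *\<^sub>R (l *\<^sub>R basis4 1) + minor x y 0 2 *\<^sub>R ((1 - l) *\<^sub>R basis4 2)
     + minor x y 0 3 *\<^sub>R basis4 3 + minor x y 1 2 *\<^sub>R basis4 3"

definition h4_bracket :: "real^4 \<Rightarrow> real^4 \<Rightarrow> real^4" where
  "h4_bracket x y =
     minor x y 0 1 *\<^sub>R basis4 1 + minor x y 0 2 *\<^sub>R (basis4 1 + basis4 2)
     + minor x y 0 3 *\<^sub>R (2 *\<^sub>R basis4 3) + minor x y 1 2 *\<^sub>R basis4 3"

lemma all_4: "(\<forall>i::4. P i) \<longleftrightarrow> P 0 \<and> P 1 \<and> P 2 \<and> P 3"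
proof -
  have "(4::4) = 0" by simp
  then show ?thesis by (metis forall_4)
qed

lemma d4_bracket_basis:
  "d4_bracket l (basis4 0) (basis4 1) = l *\<^sub>R basis4 1"
  "d4_bracket l (basis4 0) (basis4 2) = (1 - l) *\<^sub>R basis4 2"
  "d4_bracket l (basis4 0) (basis4 3) = basis4 3"
  "d4_bracket l (basis4 1) (basis4 2) = basis4 3"
  "d4_bracket l (basis4 1) (basis4 3) = 0"
  "d4_bracket l (basis4 2) (basis4 3) = 0"
  by (simp_all add: d4_bracket_def minor_def basis4_def axis_def)

lemma h4_bracket_basis:
  "h4_bracket (basis4 0) (basis4 1) = basis4 1"
  "h4_bracket (basis4 0) (basis4 2) = basis4 1 + basis4 2"
  "h4_bracket (basis4 0) (basis4 3) = 2 *\<^sub>R basis4 3"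
  "h4_bracket (basis4 1) (basis4 2) = basis4 3"
  "h4_bracket (basis4 1) (basis4 3) = 0"
  "h4_bracket (basis4 2) (basis4 3) = 0"
  by (simp_all add: h4_bracket_def minor_def basis4_def axis_def)

lemma lie_bracket_d4: "lie_bracket (d4_bracket l)"
  unfolding lie_bracket_def bilinear_def
  by (auto intro!: linearI simp: vec_eq_iff all_4 d4_bracket_def minor_def basis4_def axis_def
      algebra_simps)

lemma lie_bracket_h4: "lie_bracket h4_bracket"
  unfolding lie_bracket_def bilinear_def
  by (auto intro!: linearI simp: vec_eq_iff all_4 h4_bracket_def minor_def basis4_def axis_def
      algebra_simps)

end

theory Submission
  imports Defs
begin

text \<open>
  Type \<open>0\<close> comes from an exact symplectic form \<open>(x, y) \<mapsto> \<phi> [x, y]\<close>, type \<open>2\<close> from a left-invariant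
  complex structure. A structure of type \<open>1\<close> would give a complex covector \<open>\<theta>\<close> with
  \<open>\<theta> \<and> d\<theta> = 0\<close> whose real and imaginary parts cut out the plane \<open>D\<close> that is the range of
  \<open>\<J>\<^sub>2\<close>, together with a closed 2-form on the complex subalgebra \<open>ker \<theta>\<close> that does not vanish
  on \<open>D\<close>. For these algebras the first condition forces \<open>D\<close> to be spanned by \<open>e\<^sub>3\<close> and one of
  \<open>e\<^sub>1\<close>, \<open>e\<^sub>2\<close>, an abelian ideal; since \<open>ad e\<^sub>0\<close> has nonzero trace on it, closedness makes the
  2-form vanish on \<open>D\<close>.
\<close>

section \<open>Covectors on a Euclidean space\<close>

lemma blinfun_apply_linear_simps:
  fixes f :: "'a::euclidean_space \<Rightarrow>\<^sub>L real"
  shows "blinfun_apply f (x + y) = blinfun_apply f x + blinfun_apply f y"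
    "blinfun_apply f (x - y) = blinfun_apply f x - blinfun_apply f y"
    "blinfun_apply f (- x) = - blinfun_apply f x"
    "blinfun_apply f (c *\<^sub>R x) = c * blinfun_apply f x"
    "blinfun_apply f 0 = 0"
  by (simp_all add: blinfun.add_right blinfun.diff_right blinfun.minus_right blinfun.scaleR_right)

text \<open>The sum is the Riesz vector of \<open>f\<close>; it lets Euclidean dimension counts be
  applied to covectors.\<close>

lemma blinfun_apply_eq_inner:
  fixes f :: "'a::euclidean_space \<Rightarrow>\<^sub>L real"
  shows "blinfun_apply f x = (\<Sum>b\<in>Basis. blinfun_apply f b *\<^sub>R b) \<bullet> x"
proof -
  have "blinfun_apply f x = blinfun_apply f (\<Sum>b\<in>Basis. (x \<bullet> b) *\<^sub>R b)"
    by (simp add: euclidean_representation)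
  then show ?thesis
    by (simp add: blinfun.sum_right blinfun.scaleR_right inner_sum_left inner_commute[of x]
        mult.commute)
qed

section \<open>Structures from complex and exact symplectic structures\<close>

locale lie_algebra =
  fixes br :: "'a::euclidean_space \<Rightarrow> 'a \<Rightarrow> 'a"
  assumes lie: "lie_bracket br"
begin

lemma bilinear_br: "bilinear br"
  using lie by (simp add: lie_bracket_def)

lemma br_alt [simp]: "br x x = 0"
  using lie by (simp add: lie_bracket_def)

lemmas br_simps =
  bilinear_ladd[OF bilinear_br] bilinear_radd[OF bilinear_br]
  bilinear_lsub[OF bilinear_br] bilinear_rsub[OF bilinear_br]
  bilinear_lneg[OF bilinear_br] bilinear_rneg[OF bilinear_br]
  bilinear_lmul[OF bilinear_br] bilinear_rmul[OF bilinear_br]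
  bilinear_lzero[OF bilinear_br] bilinear_rzero[OF bilinear_br]

lemma br_antisym: "br x y = - br y x"
proof -
  have "br (x + y) (x + y) = br x y + br y x" unfolding br_simps by simp
  then have "br x y + br y x = 0" by simp
  then show ?thesis by (simp only: eq_neg_iff_add_eq_0)
qed

lemma jacobi: "br x (br y z) + br y (br z x) + br z (br x y) = 0"
  using lie by (simp add: lie_bracket_def)

lemma ad_blinfun [simp]: "blinfun_apply (ad br x) y = br x y"
  by (rule ad_apply[OF lie])

text \<open>The block diagonal \<open>J\<close> with blocks \<open>j\<close> and minus its transpose
  has zero \<open>J2_block\<close>, hence the maximal type. \<open>N\<close> is the vanishing of the
  Nijenhuis tensor of \<open>j\<close>.\<close>

lemma admits_gcs_from_complex_structure:
  assumes j: "linear j" and jj: "\<And>x. j (j x) = - x"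
    and N: "\<And>x y. br x y + j (br (j x) y) + j (br x (j y)) - br (j x) (j y) = 0"
    and d: "DIM('a) = 2 * n"
  shows "admits_gcs_of_type br n"
proof -
  define J :: "'a \<times> ('a \<Rightarrow>\<^sub>L real) \<Rightarrow> 'a \<times> ('a \<Rightarrow>\<^sub>L real)"
    where "J u = (j (fst u), - (snd u o\<^sub>L Blinfun j))" for u
  note js = linear_add[OF j] linear_diff[OF j] linear_neg[OF j] linear_scale[OF j] linear_0[OF j]
  have Bj [simp]: "blinfun_apply (Blinfun j) x = j x" for x
    using j by (simp add: bounded_linear_Blinfun_apply linear_linear)
  have "linear J"
    by (rule linearI; simp add: J_def js prod_eq_iff; intro blinfun_eqI;
        simp add: blinfun.bilinear_simps)
  moreover have "J (J u) = - u" for u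
    by (auto simp: J_def jj prod_eq_iff intro!: blinfun_eqI
        simp: blinfun.bilinear_simps)
  moreover have "pairing (J u) (J v) = pairing u v" for u v
    by (simp add: J_def pairing_def jj blinfun.bilinear_simps)
  moreover have "double_bracket br u v + J (double_bracket br (J u) v)
            + J (double_bracket br u (J v)) - double_bracket br (J u) (J v) = 0" for u v
  proof -
    obtain x \<alpha> y \<beta> where u: "u = (x, \<alpha>)" and v: "v = (y, \<beta>)" by fastforce
    \<comment> \<open>The covector component, tested on z, is \<alpha> of the identity
      \<open>N\<close> at (y, z) minus \<beta> of \<open>N\<close> at (x, z).\<close>
    have *: "blinfun_apply \<xi> (br s z) + blinfun_apply \<xi> (j (br (j s) z))
        + blinfun_apply \<xi> (j (br s (j z))) - blinfun_apply \<xi> (br (j s) (j z)) = 0"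
      for \<xi> :: "'a \<Rightarrow>\<^sub>L real" and s z
      using arg_cong[OF N[of s z], of "blinfun_apply \<xi>"]
      by (simp add: blinfun_apply_linear_simps)
    show ?thesis
      unfolding u v
      apply (simp add: J_def double_bracket_def prod_eq_iff N)
      apply (rule blinfun_eqI)
      subgoal for z
        using *[of \<alpha> y z] *[of \<beta> x z] by (simp add: blinfun.bilinear_simps)
      done
  qed
  moreover have "has_type J n"
  proof -
    have "range (J2_block J) = {0}" by (auto simp: J2_block_def J_def js)
    then show ?thesis using d by (auto simp: has_type_def)
  qed
  ultimately show ?thesis
    unfolding admits_gcs_of_type_def generalized_complex_structure_def by blast
qed

text \<open>Put \<omega>(x, y) = \<phi> [x, y], closed by the Jacobi identity. \<open>W\<close>
  sends x to \<omega>(x, .), \<open>R\<close> is its inverse, and \<open>J\<close> has the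
  off-diagonal blocks -\<open>R\<close> and \<open>W\<close>; so \<open>J2_block\<close> is onto,
  which is type 0.\<close>

lemma admits_gcs_from_exact_symplectic:
  fixes \<phi> :: "'a \<Rightarrow>\<^sub>L real"
  assumes nd: "\<And>x. (\<And>y. blinfun_apply \<phi> (br x y) = 0) \<Longrightarrow> x = 0"
    and d: "DIM('a) = 2 * n"
  shows "admits_gcs_of_type br 0"
proof -
  define W :: "'a \<Rightarrow> 'a \<Rightarrow>\<^sub>L real" where "W x = \<phi> o\<^sub>L ad br x" for x
  have W [simp]: "blinfun_apply (W x) y = blinfun_apply \<phi> (br x y)" for x y
    by (simp add: W_def)
  \<comment> \<open>Identifying covectors with vectors turns \<open>W\<close> into an endomorphism,
    for which injectivity implies surjectivity.\<close>
  define V :: "('a \<Rightarrow>\<^sub>L real) \<Rightarrow> 'a" where "V \<alpha> = (\<Sum>b\<in>Basis. blinfun_apply \<alpha> b *\<^sub>R b)" for \<alpha>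
  have V: "V \<alpha> \<bullet> y = blinfun_apply \<alpha> y" for \<alpha> y
    by (simp add: V_def blinfun_apply_eq_inner[symmetric])
  have Veq: "\<alpha> = \<beta>" if "V \<alpha> = V \<beta>" for \<alpha> \<beta>
    using V that by (metis blinfun_eqI)
  have linVW: "linear (\<lambda>x. V (W x))"
    by (rule linearI; rule euclidean_eqI;
        simp add: V inner_add_left br_simps blinfun_apply_linear_simps)
  have "inj (\<lambda>x. V (W x))"
  proof (subst linear_injective_0[OF linVW], intro allI impI)
    fix x assume "V (W x) = 0"
    then have "blinfun_apply \<phi> (br x y) = 0" for y using V[of "W x" y] by simp
    then show "x = 0" by (rule nd)
  qed
  then have "surj (\<lambda>x. V (W x))" using linVW linear_injective_imp_surjective by blast
  then have "\<exists>x. V \<alpha> = V (W x)" for \<alpha> by (rule surjD)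
  then have "\<exists>x. W x = \<alpha>" for \<alpha> using Veq by metis
  then obtain R where WR: "\<And>\<alpha>. W (R \<alpha>) = \<alpha>" by metis
  have WR' [simp]: "blinfun_apply \<phi> (br (R \<alpha>) y) = blinfun_apply \<alpha> y" for \<alpha> y
    by (metis W WR)
  have Winj: "x = x'" if "\<And>y. blinfun_apply \<phi> (br x y) = blinfun_apply \<phi> (br x' y)" for x x'
  proof -
    have "x - x' = 0" by (rule nd) (simp add: br_simps blinfun_apply_linear_simps that)
    then show ?thesis by simp
  qed
  have RW: "R (W x) = x" for x by (rule Winj) simp
  have linR: "linear R"
    by (rule linearI; rule Winj; simp add: br_simps blinfun.bilinear_simps)
  have linW: "linear W"
    by (rule linearI; rule blinfun_eqI; simp add: br_simps blinfun.bilinear_simps)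
  define J :: "'a \<times> ('a \<Rightarrow>\<^sub>L real) \<Rightarrow> 'a \<times> ('a \<Rightarrow>\<^sub>L real)"
    where "J u = (- R (snd u), W (fst u))" for u
  note ls = linear_add[OF linR] linear_diff[OF linR] linear_neg[OF linR] linear_scale[OF linR]
    linear_add[OF linW] linear_diff[OF linW] linear_neg[OF linW] linear_scale[OF linW]
  have anti: "blinfun_apply \<phi> (br x y) = - blinfun_apply \<phi> (br y x)" for x y
    by (metis br_antisym blinfun_apply_linear_simps(3))
  have "linear J" by (rule linearI) (simp_all add: J_def ls)
  moreover have "J (J u) = - u" for u by (simp add: J_def ls WR RW prod_eq_iff)
  moreover have "pairing (J u) (J v) = pairing u v" for u v
    by (simp add: J_def pairing_def br_simps blinfun_apply_linear_simps
        anti[of _ "R _"])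
  moreover have "double_bracket br u v + J (double_bracket br (J u) v)
            + J (double_bracket br u (J v)) - double_bracket br (J u) (J v) = 0" for u v
  proof -
    \<comment> \<open>Since \<open>W\<close> is onto, both covector parts come from vectors
      \<open>a\<close>, \<open>b\<close>. The vector component, paired with z through \<omega>, and
      the covector component then both reduce to \<open>closed\<close>.\<close>
    obtain x a y b where u: "u = (x, W a)" and v: "v = (y, W b)"
      by (metis WR surj_pair)
    have closed: "blinfun_apply \<phi> (br p (br q r)) - blinfun_apply \<phi> (br q (br p r))
        - blinfun_apply \<phi> (br (br p q) r) = 0" for p q r
    proof -
      have "br p (br q r) - br q (br p r) - br (br p q) r = 0"
        using jacobi[of p q r] br_antisym[of r p] br_antisym[of "br p q" r]
        by (simp add: br_simps)
      from arg_cong[OF this, of "blinfun_apply \<phi>"] show ?thesis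
        by (simp add: blinfun_apply_linear_simps)
    qed
    have "br x y - R (- (W b o\<^sub>L ad br (- a)) + (W x o\<^sub>L ad br y))
       - R (- (W y o\<^sub>L ad br x) + (W a o\<^sub>L ad br (- b))) - br a b = 0"
      apply (rule nd)
      subgoal for z
        using closed[of x y z] closed[of a b z]
        by (simp add: br_simps blinfun.bilinear_simps)
      done
    moreover have "- (W b o\<^sub>L ad br x) + (W a o\<^sub>L ad br y) + W (br (- a) y) + W (br x (- b))
       - (- (W y o\<^sub>L ad br (- a)) + (W x o\<^sub>L ad br (- b))) = 0"
      apply (rule blinfun_eqI)
      subgoal for z
        using closed[of x b z] closed[of a y z]
        by (simp add: br_simps blinfun.bilinear_simps)
      done
    ultimately show ?thesis
      unfolding u v by (simp add: J_def double_bracket_def prod_eq_iff RW br_simps)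
  qed
  moreover have "has_type J 0"
  proof -
    have "J2_block J (W (- x)) = x" for x by (simp add: J2_block_def J_def RW)
    then have "range (J2_block J) = UNIV" by (rule surjI[where f = "\<lambda>x. W (- x)"])
    then show ?thesis using d by (auto simp: has_type_def)
  qed
  ultimately show ?thesis
    unfolding admits_gcs_of_type_def generalized_complex_structure_def by blast
qed

end

section \<open>Identities for a generalized complex structure\<close>

locale gcs = lie_algebra +
  fixes J
  assumes gcs: "generalized_complex_structure br J"
begin

lemma linear_J: "linear J" and J_J: "J (J u) = - u"
  and pairing_J: "pairing (J u) (J v) = pairing u v"
  and nijenhuis: "double_bracket br u v + J (double_bracket br (J u) v)
            + J (double_bracket br u (J v)) - double_bracket br (J u) (J v) = 0"
  using gcs unfolding generalized_complex_structure_def by blast+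

text \<open>Orthogonality makes the adjoint of \<open>J\<close> its inverse, which is
  -\<open>J\<close>.\<close>

lemma pairing_J_left: "pairing (J u) v = - pairing u (J v)"
proof -
  have "pairing (J u) v = pairing (J u) (J (- J v))"
    by (simp add: linear_neg[OF linear_J] J_J)
  also have "\<dots> = pairing u (- J v)" by (rule pairing_J)
  also have "\<dots> = - pairing u (J v)"
    by (simp add: pairing_def blinfun.bilinear_simps algebra_simps)
  finally show ?thesis .
qed

text \<open>The 3-form 2<[u, v], w> of the double, expanded in terms of \<open>br\<close>; it is
  alternating because the pairing is invariant under the double bracket.\<close>

definition courant3 where
  "courant3 u v w = blinfun_apply (snd w) (br (fst u) (fst v))
     - blinfun_apply (snd v) (br (fst u) (fst w)) + blinfun_apply (snd u) (br (fst v) (fst w))"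

lemma courant3_pairing: "courant3 u v w = 2 * pairing (double_bracket br u v) w"
  by (simp add: courant3_def pairing_def double_bracket_def blinfun.bilinear_simps)

text \<open>The real part of the vanishing of the 3-form on the \<open>\<i>\<close>-eigenspace of \<open>J\<close>.\<close>

lemma courant3_J:
  "courant3 u v w = courant3 (J u) v (J w) + courant3 u (J v) (J w) + courant3 (J u) (J v) w"
proof -
  have add: "pairing (a + b) c = pairing a c + pairing b c"
    and diff: "pairing (a - b) c = pairing a c - pairing b c"
    and zero: "pairing 0 c = 0" for a b c :: "'a \<times> ('a \<Rightarrow>\<^sub>L real)"
    by (simp_all add: pairing_def blinfun.bilinear_simps field_simps)
  show ?thesis
    using arg_cong[OF nijenhuis[of u v], of "\<lambda>x. pairing x w"]
    by (simp add: add diff zero courant3_pairing pairing_J_left)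
qed

text \<open>On pure covectors the pairing sees only the block \<open>J2_block\<close>, which is
  therefore a bivector. Hence a covector annihilates its range exactly when it lies in its
  kernel.\<close>

lemma J2_skew: "blinfun_apply \<alpha> (J2_block J \<beta>) = - blinfun_apply \<beta> (J2_block J \<alpha>)"
  using pairing_J_left[of "(0, \<beta>)" "(0, \<alpha>)"]
  by (simp add: pairing_def J2_block_def)

lemma linear_J2: "linear (J2_block J)"
proof (rule linearI)
  fix a b :: "'a \<Rightarrow>\<^sub>L real" and c :: real
  show "J2_block J (a + b) = J2_block J a + J2_block J b"
    using linear_add[OF linear_J, of "(0, a)" "(0, b)"] by (simp add: J2_block_def)
  show "J2_block J (c *\<^sub>R a) = c *\<^sub>R J2_block J a"
    using linear_scale[OF linear_J, of c "(0, a)"] by (simp add: J2_block_def)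
qed

lemma J_add_covector: "J (x, \<alpha>) = J (x, 0) + J (0, \<alpha>)"
  using linear_add[OF linear_J, of "(x, 0)" "(0, \<alpha>)"] by simp

section \<open>Abelian ideals inside the range of the bivector\<close>

text \<open>The closed 2-form is evaluated on z, f, g. As f and g commute and \<open>ad\<close> z
  preserves their span, only the trace of that action survives, multiplied by the complex area of f
  and g, whose real part is \<phi>(g).\<close>

lemma J2_area_zero:
  assumes f: "J2_block J \<phi> = f" and g: "J2_block J \<gamma> = g"
    and ad_f: "\<And>z. br z f = a z *\<^sub>R f + b z *\<^sub>R g"
    and ad_g: "\<And>z. br z g = c z *\<^sub>R f + d z *\<^sub>R g"
    and fg: "br f g = 0"
    and trace: "a z + d z \<noteq> 0"
  shows "blinfun_apply \<phi> g = 0"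
proof -
  obtain \<phi>' \<gamma>' where \<phi>': "J (0, \<phi>) = (f, \<phi>')" and \<gamma>': "J (0, \<gamma>) = (g, \<gamma>')"
    using f g unfolding J2_block_def by (metis prod.collapse)
  obtain y \<eta> where y: "J (z, 0) = (y, \<eta>)" by fastforce
  have J_y: "J (y, \<eta>) = (- z, 0)" using J_J[of "(z, 0)"] y by simp
  have gf: "br g f = 0" using fg br_antisym[of g f] by simp
  have s: "blinfun_apply \<phi> f = 0" "blinfun_apply \<gamma> g = 0"
    "blinfun_apply \<gamma> f = - blinfun_apply \<phi> g"
    using J2_skew[of \<phi> \<phi>] J2_skew[of \<gamma> \<gamma>] J2_skew[of \<gamma> \<phi>] f g by simp_all
  have s': "blinfun_apply \<phi>' f = 0" "blinfun_apply \<gamma>' g = 0"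
    "blinfun_apply \<gamma>' f = - blinfun_apply \<phi>' g"
    using pairing_J[of "(0, \<phi>)" "(0, \<phi>)"] pairing_J[of "(0, \<gamma>)" "(0, \<gamma>)"]
      pairing_J[of "(0, \<phi>)" "(0, \<gamma>)"]
    by (simp_all add: pairing_def \<phi>' \<gamma>')
  define P Q where "P = blinfun_apply \<phi> g" and "Q = blinfun_apply \<phi>' g"
  define s0 s1 where "s0 = a z + d z" and "s1 = a y + d y"
  \<comment> \<open>Equations \<open>1\<close> and \<open>2\<close>, obtained from (z, 0) and from
    its image under \<open>J\<close>, are the imaginary and the real part of (P + \<i> Q)(s0 + \<i>
    s1) = 0, where s0 is nonzero.\<close>
  have 1: "P * s1 + Q * s0 = 0"
    using courant3_J[of "(z, 0)" "(0, \<phi>)" "(0, \<gamma>)"]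
    by (simp add: courant3_def \<phi>' \<gamma>' y br_simps blinfun.bilinear_simps fg ad_f[of z] ad_g[of z]
        ad_f[of y] ad_g[of y] s s'
        P_def Q_def s0_def s1_def algebra_simps)
  have 2: "P * s0 = Q * s1"
    using courant3_J[of "(y, \<eta>)" "(0, \<phi>)" "(0, \<gamma>)"]
    by (simp add: courant3_def \<phi>' \<gamma>' J_y br_simps blinfun.bilinear_simps fg ad_f[of z] ad_g[of z]
        ad_f[of y] ad_g[of y] s s'
        P_def Q_def s0_def s1_def algebra_simps)
  have "P * (s0\<^sup>2 + s1\<^sup>2) = s0 * (P * s0) + s1 * (P * s1)"
    by (simp add: power2_eq_square algebra_simps)
  also have "\<dots> = s1 * (P * s1 + Q * s0)" by (simp add: 2 algebra_simps)
  finally have "P * (s0\<^sup>2 + s1\<^sup>2) = 0" by (simp add: 1)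
  moreover have "s0\<^sup>2 + s1\<^sup>2 \<noteq> 0" using trace by (simp add: s0_def sum_power2_eq_zero_iff)
  ultimately show ?thesis unfolding P_def by (metis mult_eq_0_iff)
qed


text \<open>Otherwise the area \<phi>(g) vanishes. As \<phi>(f) = 0 by skewness, \<phi> then kills
  the plane spanned by f and g, which is the whole range; by skewness again every covector kills f,
  so f = 0.\<close>

lemma J2_trace_zero:
  assumes dim2: "dim (range (J2_block J)) = 2"
    and f: "f \<in> range (J2_block J)" and g: "g \<in> range (J2_block J)"
    and ind: "independent {f, g}" "f \<noteq> g"
    and ad_f: "\<And>z. br z f = a z *\<^sub>R f + b z *\<^sub>R g"
    and ad_g: "\<And>z. br z g = c z *\<^sub>R f + d z *\<^sub>R g"
    and fg: "br f g = 0"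
  shows "a z + d z = 0"
proof (rule ccontr)
  assume trace: "a z + d z \<noteq> 0"
  obtain \<phi> \<gamma> where \<phi>: "J2_block J \<phi> = f" and \<gamma>: "J2_block J \<gamma> = g" using f g by blast
  have 0: "blinfun_apply \<phi> g = 0"
    by (rule J2_area_zero[OF \<phi> \<gamma> ad_f ad_g fg trace])
  have "range (J2_block J) \<subseteq> span {f, g}"
    using card_ge_dim_independent[of "{f, g}" "range (J2_block J)"] f g ind dim2 by simp
  moreover have "blinfun_apply \<phi> x = 0" if "x \<in> span {f, g}" for x
    using that
  proof (induction rule: span_induct_alt)
    case (step c x y)
    then show ?case using 0 J2_skew[of \<phi> \<phi>] \<phi> by (auto simp: blinfun_apply_linear_simps)
  qed simp
  ultimately have "blinfun_apply \<phi> (J2_block J \<beta>) = 0" for \<beta> by blast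
  then have "blinfun_apply \<beta> f = 0" for \<beta> :: "'a \<Rightarrow>\<^sub>L real" using J2_skew[of \<beta> \<phi>] \<phi> by simp
  from this[of "blinfun_inner_left f"] have "f = 0" by simp
  then show False using ind dependent_zero[of "{f, g}"] by simp
qed

section \<open>The complex covector of a type 1 structure\<close>

text \<open>The kernel of \<open>J2_block\<close> is stable under \<open>J\<close>. For \<theta> =
  \<alpha> - \<i> \<alpha>', where \<alpha>' is the image of \<alpha>, the last two identities say
  \<theta>(\<open>fst (J u)\<close>) = -\<i> \<theta>(\<open>fst u\<close>), so \<theta> vanishes on
  the projection of the \<i>-eigenspace.\<close>

lemma J_annihilator:
  assumes \<alpha>: "J2_block J \<alpha> = 0"
  shows "J (0, \<alpha>) = (0, snd (J (0, \<alpha>)))" "J (0, snd (J (0, \<alpha>))) = (0, - \<alpha>)"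
    "blinfun_apply \<alpha> (fst (J u)) = - blinfun_apply (snd (J (0, \<alpha>))) (fst u)"
    "blinfun_apply (snd (J (0, \<alpha>))) (fst (J u)) = blinfun_apply \<alpha> (fst u)"
proof -
  show 1: "J (0, \<alpha>) = (0, snd (J (0, \<alpha>)))"
    using \<alpha> by (simp add: J2_block_def prod_eq_iff)
  show 2: "J (0, snd (J (0, \<alpha>))) = (0, - \<alpha>)"
    using J_J[of "(0, \<alpha>)"] 1 by (metis minus_zero uminus_Pair)
  show "blinfun_apply \<alpha> (fst (J u)) = - blinfun_apply (snd (J (0, \<alpha>))) (fst u)"
    using pairing_J_left[of u "(0, \<alpha>)"] \<alpha> by (simp add: pairing_def J2_block_def)
  show "blinfun_apply (snd (J (0, \<alpha>))) (fst (J u)) = blinfun_apply \<alpha> (fst u)"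
    using pairing_J_left[of u "(0, snd (J (0, \<alpha>)))"]
    by (simp add: pairing_def 2 blinfun.bilinear_simps)
qed

text \<open>Integrability with third argument \<alpha>: the real part of \<theta>([X, Y]) = 0 for
  projections X, Y of \<i>-eigenvectors.\<close>

lemma annihilator_bracket:
  assumes \<alpha>: "J2_block J \<alpha> = 0"
  defines "\<alpha>' \<equiv> snd (J (0, \<alpha>))"
  shows "blinfun_apply \<alpha> (br (fst u) (fst v)) =
    blinfun_apply \<alpha>' (br (fst (J u)) (fst v)) + blinfun_apply \<alpha>' (br (fst u) (fst (J v)))
    + blinfun_apply \<alpha> (br (fst (J u)) (fst (J v)))"
  using courant3_J[of u v "(0, \<alpha>)"] J_annihilator(1)[OF \<alpha>]
  by (simp add: courant3_def \<alpha>'_def[symmetric] br_simps)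

text \<open>Any nonzero \<alpha> annihilating the range lies in the kernel of
  \<open>J2_block\<close>, and so does its image under \<open>J\<close>. The two are independent, so
  in dimension 4 their common kernel is a plane, and it contains the range.\<close>

lemma type_one_annihilator:
  assumes dim2: "dim (range (J2_block J)) = 2" and d4: "DIM('a) = 4"
  shows "\<exists>\<alpha>. J2_block J \<alpha> = 0 \<and> range (J2_block J) =
       {x. blinfun_apply \<alpha> x = 0 \<and> blinfun_apply (snd (J (0, \<alpha>))) x = 0}"
proof -
  let ?D = "range (J2_block J)"
  have sub: "subspace ?D" using linear_J2 by (simp add: linear_subspace_image)
  have "span ?D \<noteq> UNIV"
  proof
    assume UNIV: "span ?D = UNIV"
    have "dim ?D = dim (span ?D)" by simp
    also have "\<dots> = 4" unfolding UNIV using d4 by simp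
    finally show False using dim2 by simp
  qed
  then obtain a where a: "a \<noteq> 0" "\<And>x. x \<in> ?D \<Longrightarrow> a \<bullet> x = 0"
    using span_not_UNIV_orthogonal span_base by metis
  define \<alpha> where "\<alpha> = blinfun_inner_left a"
  have J2\<alpha>: "J2_block J \<alpha> = 0"
  proof -
    have "blinfun_apply \<beta> (J2_block J \<alpha>) = 0" for \<beta> :: "'a \<Rightarrow>\<^sub>L real"
      using J2_skew[of \<beta> \<alpha>] a(2)[of "J2_block J \<beta>"] by (simp add: \<alpha>_def inner_commute)
    from this[of "blinfun_inner_left (J2_block J \<alpha>)"] show ?thesis by simp
  qed
  define \<alpha>' where "\<alpha>' = snd (J (0, \<alpha>))"
  note J' = J_annihilator[OF J2\<alpha>, folded \<alpha>'_def]
  define a' where "a' = (\<Sum>b\<in>Basis. blinfun_apply \<alpha>' b *\<^sub>R b)"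
  have a': "blinfun_apply \<alpha>' x = a' \<bullet> x" for x
    unfolding a'_def by (rule blinfun_apply_eq_inner)
  have ap: "blinfun_apply \<alpha> x = a \<bullet> x" for x by (simp add: \<alpha>_def inner_commute)
  \<comment> \<open>Proportionality would give \<open>J\<close> a real eigenvalue c; concretely,
    |a|^2 = -c^2 |a|^2.\<close>
  have ne: "a' \<noteq> c *\<^sub>R a" for c
  proof
    assume c: "a' = c *\<^sub>R a"
    have "a \<bullet> a = a' \<bullet> fst (J (a, 0))" using J'(4)[of "(a, 0)"] by (simp add: ap a')
    also have "\<dots> = c * (a \<bullet> fst (J (a, 0)))" by (simp add: c)
    also have "\<dots> = c * - (a' \<bullet> a)" using J'(3)[of "(a, 0)"] by (simp add: ap a')
    also have "\<dots> = - (c\<^sup>2 * (a \<bullet> a))" by (simp add: c power2_eq_square)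
    finally have "(1 + c\<^sup>2) * (a \<bullet> a) = 0" by (simp add: algebra_simps)
    moreover have "1 + c\<^sup>2 \<noteq> 0" by (metis add_nonneg_eq_0_iff zero_le_one zero_le_power2 zero_neq_one)
    ultimately show False using a(1) by simp
  qed
  have ind: "independent {a', a}" "a' \<noteq> a"
    using ne[of 1] a(1) ne
    by (auto simp: independent_insert span_singleton)
  define S where "S = {x. \<forall>y \<in> span {a', a}. orthogonal y x}"
  have "dim (span {a', a}) = 2" using ind by (simp add: dim_eq_card_independent)
  then have "dim S = 2"
    using dim_subspace_orthogonal_to_vectors[of "span {a', a}" UNIV] d4
    by (simp add: S_def subspace_span)
  have S: "x \<in> S \<longleftrightarrow> blinfun_apply \<alpha> x = 0 \<and> blinfun_apply \<alpha>' x = 0" for x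
  proof -
    have "a \<in> span {a', a}" "a' \<in> span {a', a}" by (simp_all add: span_base)
    moreover have "y \<bullet> x = 0" if "y \<in> span {a', a}" "a \<bullet> x = 0" "a' \<bullet> x = 0" for y
      using that(1) by (induction rule: span_induct_alt) (auto simp: inner_add_left that)
    ultimately show ?thesis by (auto simp: S_def orthogonal_def ap a')
  qed
  have "?D \<subseteq> S"
  proof
    fix x assume x: "x \<in> ?D"
    then obtain \<beta> where \<beta>: "x = J2_block J \<beta>" by blast
    have "blinfun_apply \<alpha>' x = 0"
      using J2_skew[of \<alpha>' \<beta>] J'(2) \<beta> by (simp add: J2_block_def)
    then show "x \<in> S" using a(2)[OF x] by (simp add: S ap)
  qed
  moreover have "subspace S" by (auto simp: subspace_def S blinfun_apply_linear_simps)
  ultimately have "?D = S"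
    using subspace_dim_equal[OF sub] \<open>dim S = 2\<close> dim2 by simp
  also have "S = {x. blinfun_apply \<alpha> x = 0 \<and> blinfun_apply \<alpha>' x = 0}" using S by blast
  finally show ?thesis using J2\<alpha> unfolding \<alpha>'_def by blast
qed

text \<open>The kernel of \<open>\<theta> = \<alpha> - \<i> \<alpha>'\<close> in the complexified algebra is the projection of an
  eigenspace of \<open>J\<close>, hence a subalgebra.\<close>

lemma type_one_integrable:
  assumes J2: "J2_block J \<alpha> = 0"
    and D: "range (J2_block J) =
       {x. blinfun_apply \<alpha> x = 0 \<and> blinfun_apply (snd (J (0, \<alpha>))) x = 0}"
  defines "\<theta> \<equiv> \<lambda>x. Complex (blinfun_apply \<alpha> x) (- blinfun_apply (snd (J (0, \<alpha>))) x)"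
  shows "\<theta> z * (\<theta> x * \<theta> (br y z) + \<theta> y * \<theta> (br z x) + \<theta> z * \<theta> (br x y)) = 0"
proof -
  define \<alpha>' where "\<alpha>' = snd (J (0, \<alpha>))"
  note J' = J_annihilator[OF J2, folded \<alpha>'_def]
  \<comment> \<open>This is \<theta>(p + \<i> q) = 0. Such a vector is, up to the factor -\<i>, the
    projection of an eigenvector u - \<i> J u; the covector part of u supplies the missing element
    of the range.\<close>
  define ker where "ker p q \<longleftrightarrow> blinfun_apply \<alpha> p + blinfun_apply \<alpha>' q = 0 \<and>
      blinfun_apply \<alpha> q = blinfun_apply \<alpha>' p" for p q
  have lift: "\<exists>u. fst u = q \<and> fst (J u) = p" if "ker p q" for p q
  proof -
    have "p - fst (J (q, 0)) \<in> range (J2_block J)"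
      using that J'(3)[of "(q, 0)"] J'(4)[of "(q, 0)"]
      by (simp add: D \<alpha>'_def[symmetric] ker_def blinfun_apply_linear_simps)
    then obtain \<gamma> where "p - fst (J (q, 0)) = fst (J (0, \<gamma>))" by (auto simp: J2_block_def)
    then have "fst (J (q, \<gamma>)) = p" by (simp add: J_add_covector[of q \<gamma>] algebra_simps)
    then show ?thesis by (metis fst_conv)
  qed
  have re: "blinfun_apply \<alpha> (br q s) = blinfun_apply \<alpha>' (br p s) + blinfun_apply \<alpha>' (br q r)
      + blinfun_apply \<alpha> (br p r)" if pq: "ker p q" and rs: "ker r s" for p q r s
  proof -
    obtain u v where "fst u = q" "fst (J u) = p" "fst v = s" "fst (J v) = r"
      using lift[OF pq] lift[OF rs] by blast
    then show ?thesis using annihilator_bracket[OF J2, of u v] by (simp add: \<alpha>'_def)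
  qed
  define A A' where "A = blinfun_apply \<alpha>" and "A' = blinfun_apply \<alpha>'"
  \<comment> \<open>Here p + \<i> q = \<theta>(z) x - \<theta>(x) z and r + \<i> s = \<theta>(z) y -
    \<theta>(y) z, both in the kernel of \<theta>. Replacing the first by \<i> times itself gives
    the imaginary part.\<close>
  define p q where "p = A z *\<^sub>R x - A x *\<^sub>R z" and "q = A' x *\<^sub>R z - A' z *\<^sub>R x"
  define r s where "r = A z *\<^sub>R y - A y *\<^sub>R z" and "s = A' y *\<^sub>R z - A' z *\<^sub>R y"
  have k: "ker p q" "ker (- q) p" "ker r s"
    by (simp_all add: ker_def p_def q_def r_def s_def A_def A'_def blinfun_apply_linear_simps)
  have zx: "br z x = - br x z" and zy: "br z y = - br y z" by (rule br_antisym)+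
  note lin = blinfun_apply_linear_simps[of \<alpha>, folded A_def]
    blinfun_apply_linear_simps[of \<alpha>', folded A'_def]
  show ?thesis
    using re[OF k(1,3)] re[OF k(2,3)]
    by (simp add: \<theta>_def \<alpha>'_def[symmetric] A_def[symmetric] A'_def[symmetric]
        complex_eq_iff p_def q_def r_def s_def br_simps zx zy lin algebra_simps)
qed

text \<open>All that the case analysis needs, free of \<alpha> and \<open>J\<close>: the identity is
  \<theta> \<and> d\<theta> = 0 up to sign, multiplied by \<theta>(z).\<close>

lemma type_one_form:
  assumes dim2: "dim (range (J2_block J)) = 2" and d4: "DIM('a) = 4"
  shows "\<exists>\<theta> :: 'a \<Rightarrow> complex. linear \<theta> \<and> range (J2_block J) = {x. \<theta> x = 0} \<and>
    (\<forall>x y z. \<theta> z * (\<theta> x * \<theta> (br y z) + \<theta> y * \<theta> (br z x) + \<theta> z * \<theta> (br x y)) = 0)"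
proof -
  obtain \<alpha> where \<alpha>: "J2_block J \<alpha> = 0" and D: "range (J2_block J) =
       {x. blinfun_apply \<alpha> x = 0 \<and> blinfun_apply (snd (J (0, \<alpha>))) x = 0}"
    using type_one_annihilator[OF dim2 d4] by blast
  define \<theta> where "\<theta> x = Complex (blinfun_apply \<alpha> x) (- blinfun_apply (snd (J (0, \<alpha>))) x)" for x
  have "linear \<theta>"
    by (rule linearI) (simp_all add: \<theta>_def complex_eq_iff blinfun_apply_linear_simps)
  moreover have "range (J2_block J) = {x. \<theta> x = 0}"
    by (simp add: D \<theta>_def complex_eq_iff)
  ultimately show ?thesis
    using type_one_integrable[OF \<alpha> D, folded \<theta>_def] by (intro exI[of _ \<theta>]) simp
qed

end

section \<open>Existence of types 0 and 2 on the given algebras\<close>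

lemma basis4_nth [simp]: "basis4 i $ j = (if i = j then 1 else 0)"
  by (auto simp: basis4_def axis_def)

lemma independent_basis4: "i \<noteq> j \<Longrightarrow> independent {basis4 i, basis4 j}"
  by (rule independent_mono[OF independent_Basis]) (auto simp: basis4_def)

lemma basis4_eq_iff [simp]: "basis4 i = basis4 j \<longleftrightarrow> i = j"
  by (simp add: basis4_def axis_eq_axis)

lemma type_one_dim:
  fixes J :: "(real^4) \<times> ((real^4) \<Rightarrow>\<^sub>L real) \<Rightarrow> (real^4) \<times> ((real^4) \<Rightarrow>\<^sub>L real)"
  assumes "has_type J 1"
  shows "dim (range (J2_block J)) = 2"
  using assms by (auto simp: has_type_def)

lemma d4_type_0: "admits_gcs_of_type (d4_bracket l) 0"
proof -
  interpret lie_algebra "d4_bracket l" by unfold_locales (rule lie_bracket_d4)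
  show ?thesis
  \<comment> \<open>The dual covector of e3 gives the nondegenerate form e^0 \<and> e^3 + e^1 \<and>
    e^2.\<close>
  proof (rule admits_gcs_from_exact_symplectic[where \<phi> = "blinfun_inner_left (basis4 3)" and n = 2])
    fix x assume *: "\<And>y. blinfun_apply (blinfun_inner_left (basis4 3)) (d4_bracket l x y) = 0"
    show "x = 0"
      using *[of "basis4 0"] *[of "basis4 1"] *[of "basis4 2"] *[of "basis4 3"]
      by (simp add: basis4_def inner_axis inner_axis' d4_bracket_def minor_def axis_def
          vec_eq_iff all_4)
  qed simp
qed

lemma h4_type_0: "admits_gcs_of_type h4_bracket 0"
proof -
  interpret lie_algebra h4_bracket by unfold_locales (rule lie_bracket_h4)
  show ?thesis
  \<comment> \<open>The dual covector of e3 gives 2 e^0 \<and> e^3 + e^1 \<and> e^2.\<close>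
  proof (rule admits_gcs_from_exact_symplectic[where \<phi> = "blinfun_inner_left (basis4 3)" and n = 2])
    fix x assume *: "\<And>y. blinfun_apply (blinfun_inner_left (basis4 3)) (h4_bracket x y) = 0"
    show "x = 0"
      using *[of "basis4 0"] *[of "basis4 1"] *[of "basis4 2"] *[of "basis4 3"]
      by (simp add: basis4_def inner_axis inner_axis' h4_bracket_def minor_def axis_def
          vec_eq_iff all_4)
  qed simp
qed

lemma d4_type_2:
  assumes "l \<noteq> 0"
  shows "admits_gcs_of_type (d4_bracket l) 2"
proof -
  interpret lie_algebra "d4_bracket l" by unfold_locales (rule lie_bracket_d4)
  \<comment> \<open>\<open>j\<close> sends e0 to -l e1 and e2 to e3. With -t e1 in place of -l e1,
    integrability at (e0, e2) reads (1 - l) + t - 1 = 0, whence the factor l.\<close>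
  define j :: "real^4 \<Rightarrow> real^4" where "j x = (x $ 1 / l) *\<^sub>R basis4 0 - (l * x $ 0) *\<^sub>R basis4 1
    - x $ 3 *\<^sub>R basis4 2 + x $ 2 *\<^sub>R basis4 3" for x
  show ?thesis
  proof (rule admits_gcs_from_complex_structure[where j = j])
    show "linear j"
      by (rule linearI) (simp_all add: j_def vec_eq_iff all_4 field_simps assms)
    show "j (j x) = - x" for x
      by (simp add: j_def vec_eq_iff all_4 assms)
    show "d4_bracket l x y + j (d4_bracket l (j x) y) + j (d4_bracket l x (j y))
        - d4_bracket l (j x) (j y) = 0" for x y
      by (simp add: j_def vec_eq_iff all_4 d4_bracket_def minor_def field_simps assms)
  qed simp
qed

lemma h4_type_2: "admits_gcs_of_type h4_bracket 2"
proof -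
  interpret lie_algebra h4_bracket by unfold_locales (rule lie_bracket_h4)
  \<comment> \<open>\<open>j\<close> sends e0 to e2 and e1 to e3; at (e0, e1) the terms e1 + e1 - 2
    e1 cancel.\<close>
  define j :: "real^4 \<Rightarrow> real^4" where "j x = x $ 0 *\<^sub>R basis4 2 - x $ 2 *\<^sub>R basis4 0
    + x $ 1 *\<^sub>R basis4 3 - x $ 3 *\<^sub>R basis4 1" for x
  show ?thesis
  proof (rule admits_gcs_from_complex_structure[where j = j])
    show "linear j"
      by (rule linearI) (simp_all add: j_def vec_eq_iff all_4 algebra_simps)
    show "j (j x) = - x" for x
      by (simp add: j_def vec_eq_iff all_4)
    show "h4_bracket x y + j (h4_bracket (j x) y) + j (h4_bracket x (j y))
        - h4_bracket (j x) (j y) = 0" for x y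
      by (simp add: j_def vec_eq_iff all_4 h4_bracket_def minor_def algebra_simps)
  qed simp
qed

section \<open>Non-existence of type 1\<close>

text \<open>The condition on 1/2 separates the weights l and 1 - l of e1 and e2, forcing
  \<theta>(e1) \<theta>(e2) = 0. The other two make the trace of \<open>ad\<close> e0 nonzero on the
  resulting planes: l + 1 on e1, e3 and 2 - l on e2, e3.\<close>

lemma d4_not_type_1:
  assumes "l \<noteq> 1 / 2" "l \<noteq> 2" "l \<noteq> - 1"
  shows "\<not> admits_gcs_of_type (d4_bracket l) 1"
proof
  assume "admits_gcs_of_type (d4_bracket l) 1"
  then obtain J where J: "generalized_complex_structure (d4_bracket l) J" "has_type J 1"
    unfolding admits_gcs_of_type_def by blast
  interpret gcs "d4_bracket l" J by unfold_locales (rule lie_bracket_d4, rule J)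
  note dim2 = type_one_dim[OF J(2)]
  have DIM: "DIM(real^4) = 4" by simp
  obtain \<theta> :: "real^4 \<Rightarrow> complex" where lin: "linear \<theta>" and D: "range (J2_block J) = {x. \<theta> x = 0}"
    and int: "\<forall>x y z. \<theta> z * (\<theta> x * \<theta> (d4_bracket l y z) + \<theta> y * \<theta> (d4_bracket l z x)
      + \<theta> z * \<theta> (d4_bracket l x y)) = 0"
    using type_one_form[OF dim2 DIM] by blast
  note \<theta> = linear_0[OF lin] linear_neg[OF lin] linear_add[OF lin] linear_diff[OF lin]
    linear_scale[OF lin]
  \<comment> \<open>At z = e3, x = e1, y = e2 only the term with [e1, e2] = e3 survives, leaving
    \<theta>(e3)^3 = 0.\<close>
  have "\<theta> (basis4 3) = 0"
    using int[rule_format, of "basis4 3" "basis4 1" "basis4 2"] br_antisym[of "basis4 3" "basis4 1"]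
    by (simp add: d4_bracket_basis \<theta>)
  then have e3: "basis4 3 \<in> range (J2_block J)" by (simp add: D)
  have "\<theta> (basis4 2) * (of_real (2 * l - 1) * \<theta> (basis4 1) * \<theta> (basis4 2)) = 0"
    using int[rule_format, of "basis4 2" "basis4 0" "basis4 1"] br_antisym[of "basis4 2" "basis4 0"]
      \<open>\<theta> (basis4 3) = 0\<close>
    by (simp add: d4_bracket_basis \<theta> scaleR_conv_of_real[where 'a = complex] algebra_simps)
  moreover have "of_real (2 * l - 1) \<noteq> (0::complex)"
    unfolding of_real_eq_0_iff using assms(1) by simp
  ultimately have "\<theta> (basis4 1) = 0 \<or> \<theta> (basis4 2) = 0" by auto
  then show False
  proof
    assume "\<theta> (basis4 1) = 0"
    then have e1: "basis4 1 \<in> range (J2_block J)" by (simp add: D)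
    \<comment> \<open>From [z, e1] = l z0 e1 - z2 e3 and [z, e3] = z0 e3 the trace is (l + 1) z0,
      taken at z = e0.\<close>
    have "l * basis4 0 $ 0 + basis4 0 $ 0 = 0"
      by (rule J2_trace_zero[OF dim2 e1 e3 independent_basis4,
          where b = "\<lambda>z. - z $ 2" and c = "\<lambda>_. 0"])
        (simp_all add: d4_bracket_basis, simp_all add: vec_eq_iff all_4 d4_bracket_def minor_def)
    then show False using assms(3) by simp
  next
    assume "\<theta> (basis4 2) = 0"
    then have e2: "basis4 2 \<in> range (J2_block J)" by (simp add: D)
    have "(1 - l) * basis4 0 $ 0 + basis4 0 $ 0 = 0"
      by (rule J2_trace_zero[OF dim2 e2 e3 independent_basis4,
          where b = "\<lambda>z. z $ 1" and c = "\<lambda>_. 0"])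
        (simp_all add: d4_bracket_basis, simp_all add: vec_eq_iff all_4 d4_bracket_def minor_def)
    then show False using assms(2) by simp
  qed
qed

text \<open>Modulo e3, \<open>ad\<close> e0 is a Jordan block on e1, e2, so integrability yields
  \<theta>(e1)^3 = 0 and leaves only the plane of e1, e3, where its trace is 3.\<close>

lemma h4_not_type_1: "\<not> admits_gcs_of_type h4_bracket 1"
proof
  assume "admits_gcs_of_type h4_bracket 1"
  then obtain J where J: "generalized_complex_structure h4_bracket J" "has_type J 1"
    unfolding admits_gcs_of_type_def by blast
  interpret gcs h4_bracket J by unfold_locales (rule lie_bracket_h4, rule J)
  note dim2 = type_one_dim[OF J(2)]
  have DIM: "DIM(real^4) = 4" by simp
  obtain \<theta> :: "real^4 \<Rightarrow> complex" where lin: "linear \<theta>" and D: "range (J2_block J) = {x. \<theta> x = 0}"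
    and int: "\<forall>x y z. \<theta> z * (\<theta> x * \<theta> (h4_bracket y z) + \<theta> y * \<theta> (h4_bracket z x)
      + \<theta> z * \<theta> (h4_bracket x y)) = 0"
    using type_one_form[OF dim2 DIM] by blast
  note \<theta> = linear_0[OF lin] linear_neg[OF lin] linear_add[OF lin] linear_diff[OF lin]
    linear_scale[OF lin]
  have "\<theta> (basis4 3) = 0"
    using int[rule_format, of "basis4 3" "basis4 1" "basis4 2"] br_antisym[of "basis4 3" "basis4 1"]
    by (simp add: h4_bracket_basis \<theta>)
  then have e3: "basis4 3 \<in> range (J2_block J)" by (simp add: D)
  have "\<theta> (basis4 1) * (\<theta> (basis4 1) * \<theta> (basis4 1)) = 0"
    using int[rule_format, of "basis4 1" "basis4 2" "basis4 0"] br_antisym[of "basis4 2" "basis4 0"]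
      \<open>\<theta> (basis4 3) = 0\<close>
    by (simp add: h4_bracket_basis \<theta> algebra_simps)
  then have e1: "basis4 1 \<in> range (J2_block J)" by (simp add: D)
  have "basis4 0 $ 0 + 2 * basis4 0 $ 0 = 0"
    by (rule J2_trace_zero[OF dim2 e1 e3 independent_basis4,
          where b = "\<lambda>z. - z $ 2" and c = "\<lambda>_. 0"])
      (simp_all add: h4_bracket_basis, simp_all add: vec_eq_iff all_4 h4_bracket_def minor_def)
  then show False by simp
qed

theorem proposition5p5:
  "(\<forall>l::real. l \<ge> 1 / 2 \<and> l \<noteq> 1 / 2 \<and> l \<noteq> 2 \<longrightarrow>
      admits_gcs_of_type (d4_bracket l) 0 \<and>
      admits_gcs_of_type (d4_bracket l) 2 \<and>
      \<not> admits_gcs_of_type (d4_bracket l) 1)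
   \<and> (admits_gcs_of_type h4_bracket 0 \<and>
      admits_gcs_of_type h4_bracket 2 \<and>
      \<not> admits_gcs_of_type h4_bracket 1)"
  \<comment> \<open>The conditions that l is neither 0 nor -1 follow from l \<ge> 1/2.\<close>
  by (intro conjI allI impI d4_type_0 h4_type_0 d4_type_2 h4_type_2 d4_not_type_1 h4_not_type_1)
    auto

end
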